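(* Let $\mu$ be a Borel probability measure on $\Sigma_m$ and let $(F_k)_{k\ge1}$ be a sequence of real-valued measurable, $\mu$-square-integrable functions defined on $\Sigma_m$. Suppose that there exist $C>0$ and $0<\eta<q^{3/2}$ such that for any $i\ge1$ with $q\nmid i$ and any integers $j_1,j_2\ge0$, $$\mathrm{cov}_{\mu}\left(F_{iq^{j_1}}, F_{iq^{j_2}}\right)\leq C\eta^{\frac{j_1+j_2}{2}}.$$ Then for $\mathbb{P}_{\mu}$-a.e. $x\in\Sigma_m$, $$\lim_{n\to\infty}\frac{1}{n}\sum_{k=1}^{n}\left(F_k(x_{|\Lambda_{i(k)}})-\mathbb{E}_{\mu}F_k\right)=0.$$
   Context: Let $m\ge2$, $q\ge2$ be integers, $S=\{0,1,\dots,m-1\}$, and let $\Sigma_m$ be the space of one-sided infinite sequences over $S$. $[u]$ denotes the cylinder of all sequences starting with the word $u$. Index sequences in $\Sigma_m$ as $x=(x_n)_{n\ge1}$. For $i\ge1$ with $q\nmid i$ let $\Lambda_i=\{iq^j:j\ge0\}$; these sets partition $\{1,2,\dots\}$. For $k\ge1$, $i(k)$ is the unique integer with $q\nmid i(k)$ and $k=i(k)q^j$ for some $j\ge0$. The restriction $x_{|\Lambda_i}=(x_i,x_{iq},x_{iq^2},\dots)$ is regarded as an element of $\Sigma_m$. The telescopic product measure $\mathbb{P}_\mu$ is the probability measure on $\Sigma_m=\prod_{i\ge1,\,q\nmid i}S^{\Lambda_i}$ which is the product of copies of $\mu$ on the factors $S^{\Lambda_i}\cong\Sigma_m$; that is,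 for each word $u=u_1\cdots u_n$, $\mathbb{P}_\mu([u])=\prod_{i\le n,\ q\nmid i}\mu([u_{|\Lambda_i}])$, where $u_{|\Lambda_i}=u_iu_{iq}\cdots u_{iq^r}$ with $r$ the largest integer such that $iq^r\le n$. $\mathbb{E}_\mu$ is expectation with respect to $\mu$ and $\mathrm{cov}_\mu(f,g)=\mathbb{E}_\mu[(f-\mathbb{E}_\mu f)(g-\mathbb{E}_\mu g)]$. *)

theory Defs
  imports "HOL-Probability.Probability"
begin

(* Sequences over {0,...,m-1} indexed by {1,2,...}: extensional functions, i.e. functions
   on nat that take the value undefined at the irrelevant index 0. *)
definition Sigma_space :: "nat \<Rightarrow> (nat \<Rightarrow> nat) set" where
  "Sigma_space m = (\<Pi>\<^sub>E n\<in>{1..}. {..<m})"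

definition Sigma_topology :: "nat \<Rightarrow> (nat \<Rightarrow> nat) topology" where
  "Sigma_topology m = product_topology (\<lambda>n. discrete_topology {..<m}) {1..}"

definition Sigma_borel :: "nat \<Rightarrow> (nat \<Rightarrow> nat) measure" where
  "Sigma_borel m = sigma (Sigma_space m) {U. openin (Sigma_topology m) U}"

definition roots :: "nat \<Rightarrow> nat set" where
  "roots q = {i. 1 \<le> i \<and> \<not> q dvd i}"

definition root_of :: "nat \<Rightarrow> nat \<Rightarrow> nat" where
  "root_of q k = (THE i. i \<in> roots q \<and> (\<exists>j. k = i * q ^ j))"

definition exponent_of :: "nat \<Rightarrow> nat \<Rightarrow> nat" where
  "exponent_of q k = (THE j. \<exists>i\<in>roots q. k = i * q ^ j)"

(* The restriction of x to {i * q^j | j \<ge> 0}, renumbered by 1, 2, ... *)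
definition restr :: "nat \<Rightarrow> nat \<Rightarrow> (nat \<Rightarrow> nat) \<Rightarrow> (nat \<Rightarrow> nat)" where
  "restr q i x = (\<lambda>n\<in>{1..}. x (i * q ^ (n - 1)))"

(* The identification of the product of the factors over roots q with the sequence space:
   the inverse of x \<mapsto> (restr q i x), i \<in> roots q. *)
definition assemble :: "nat \<Rightarrow> (nat \<Rightarrow> nat \<Rightarrow> nat) \<Rightarrow> (nat \<Rightarrow> nat)" where
  "assemble q y = (\<lambda>k\<in>{1..}. y (root_of q k) (exponent_of q k + 1))"

definition telescopic :: "nat \<Rightarrow> nat \<Rightarrow> (nat \<Rightarrow> nat) measure \<Rightarrow> (nat \<Rightarrow> nat) measure" where
  "telescopic m q \<mu> = distr (\<Pi>\<^sub>M i\<in>roots q. \<mu>) (Sigma_borel m) (assemble q)"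

definition cov :: "'a measure \<Rightarrow> ('a \<Rightarrow> real) \<Rightarrow> ('a \<Rightarrow> real) \<Rightarrow> real" where
  "cov M f g =
     (LINT x|M. (f x - integral\<^sup>L M f) * (g x - integral\<^sup>L M g))"

definition cylinder :: "nat \<Rightarrow> nat \<Rightarrow> (nat \<Rightarrow> nat) \<Rightarrow> (nat \<Rightarrow> nat) set" where
  "cylinder m n u = {x \<in> Sigma_space m. \<forall>k\<in>{1..n}. x k = u k}"

lemma topspace_Sigma_topology: "topspace (Sigma_topology m) = Sigma_space m"
  by (simp add: Sigma_topology_def Sigma_space_def)

lemma space_Sigma_borel: "space (Sigma_borel m) = Sigma_space m"
  unfolding Sigma_borel_def by (rule space_measure_of_conv)

lemma sets_Sigma_borel_sigma:
  "sets (Sigma_borel m) = sigma_sets (Sigma_space m) {U. openin (Sigma_topology m) U}"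
  unfolding Sigma_borel_def
  by (rule sets_measure_of) (use openin_subset topspace_Sigma_topology in blast)

lemma cylinder_in_PiM:
  "cylinder m n u \<in> sets (\<Pi>\<^sub>M n\<in>{1::nat..}. count_space {..<m})"
proof -
  let ?P = "\<Pi>\<^sub>M n\<in>{1::nat..}. count_space {..<m}"
  have sp: "space ?P = Sigma_space m"
    by (simp add: space_PiM Sigma_space_def)
  have "{x \<in> space ?P. \<forall>k\<in>{1..n}. x k = u k} \<in> sets ?P"
  proof (rule sets.sets_Collect_finite_All)
    fix k assume k: "k \<in> {1..n}"
    have 1: "(\<lambda>x. x k) \<in> measurable ?P (count_space {..<m})"
      using k by (intro measurable_component_singleton) auto
    have "(\<lambda>x. x k) -` ({u k} \<inter> {..<m}) \<inter> space ?P \<in> sets ?P"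
      by (rule measurable_sets[OF 1]) auto
    moreover have "(\<lambda>x. x k) -` ({u k} \<inter> {..<m}) \<inter> space ?P = {x \<in> space ?P. x k = u k}"
      using k by (auto simp: space_PiM PiE_def Pi_def)
    ultimately show "{x \<in> space ?P. x k = u k} \<in> sets ?P" by simp
  qed auto
  then show ?thesis unfolding cylinder_def sp .
qed

lemma sets_Sigma_borel:
  "sets (Sigma_borel m) = sets (\<Pi>\<^sub>M n\<in>{1..}. count_space {..<m})" (is "_ = sets ?P")
proof
  have sp: "space ?P = Sigma_space m"
    by (simp add: space_PiM Sigma_space_def)
  show "sets (Sigma_borel m) \<subseteq> sets ?P"
    unfolding sets_Sigma_borel_sigma sp[symmetric]
  proof (rule sets.sigma_sets_subset, safe)
    fix U assume U: "openin (Sigma_topology m) U"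
    then have US: "U \<subseteq> Sigma_space m"
      using openin_subset topspace_Sigma_topology by metis
    have ex: "\<exists>n. cylinder m n x \<subseteq> U" if x: "x \<in> U" for x
    proof -
      obtain V where V: "finite {i \<in> {1..}. V i \<noteq> topspace (discrete_topology {..<m})}"
        "x \<in> Pi\<^sub>E {1..} V" "Pi\<^sub>E {1..} V \<subseteq> U"
        using U x unfolding Sigma_topology_def openin_product_topology_alt by meson
      from V(1) obtain n where "\<forall>i\<in>{i \<in> {1..}. V i \<noteq> topspace (discrete_topology {..<m})}. i \<le> n"
        unfolding finite_nat_set_iff_bounded_le by (rule exE)
      then have n: "i \<le> n" if "i \<in> {1..}" "V i \<noteq> {..<m}" for i
        using that by simp
      have "cylinder m n x \<subseteq> Pi\<^sub>E {1..} V"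
      proof
        fix y assume y: "y \<in> cylinder m n x"
        show "y \<in> Pi\<^sub>E {1..} V"
        proof (rule PiE_I)
          fix i :: nat assume i: "i \<in> {1..}"
          show "y i \<in> V i"
          proof (cases "V i = {..<m}")
            case True
            then show ?thesis using y i by (auto simp: cylinder_def Sigma_space_def)
          next
            case False
            then have "y i = x i" using n[OF i] y i by (auto simp: cylinder_def)
            then show ?thesis using V(2) i by auto
          qed
        next
          fix i :: nat assume "i \<notin> {1..}"
          then show "y i = undefined" using y by (auto simp: cylinder_def Sigma_space_def PiE_def extensional_def)
        qed
      qed
      then show ?thesis using V(3) by blast
    qed
    let ?K = "(\<Union>n. (\<lambda>u. cylinder m n u) ` (PiE {1..n} (\<lambda>_. {..<m})))"
    have cnt: "countable ?K"
      by (intro countable_UN countable_image countableI_type countable_finite[OF finite_PiE]) simp_all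
    have "U = \<Union>{A \<in> ?K. A \<subseteq> U}"
    proof
      show "U \<subseteq> \<Union>{A \<in> ?K. A \<subseteq> U}"
      proof
        fix x assume x: "x \<in> U"
        then obtain n where n: "cylinder m n x \<subseteq> U" using ex by blast
        have eq: "cylinder m n x = cylinder m n (restrict x {1..n})"
          unfolding cylinder_def by (rule Collect_cong) simp
        have "restrict x {1..n} \<in> PiE {1..n} (\<lambda>_. {..<m})"
          using subsetD[OF US x] by (auto simp: Sigma_space_def)
        then have "cylinder m n x \<in> ?K" using eq by blast
        moreover have "x \<in> cylinder m n x" using x US by (auto simp: cylinder_def)
        ultimately show "x \<in> \<Union>{A \<in> ?K. A \<subseteq> U}" using n by blast
      qed
    qed auto
    moreover have "\<Union>{A \<in> ?K. A \<subseteq> U} \<in> sets ?P"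
    proof (rule sets.countable_Union)
      show "countable {A \<in> ?K. A \<subseteq> U}" by (rule countable_subset[OF _ cnt]) auto
      show "{A \<in> ?K. A \<subseteq> U} \<subseteq> sets ?P" using cylinder_in_PiM by auto
    qed
    ultimately show "U \<in> sets ?P" by simp
  qed
  show "sets ?P \<subseteq> sets (Sigma_borel m)"
    unfolding sets_PiM_single space_count_space sets_Sigma_borel_sigma Sigma_space_def[symmetric]
  proof (rule sigma_sets_mono)
    have "{f \<in> Sigma_space m. f i \<in> A} \<in> sigma_sets (Sigma_space m) {U. openin (Sigma_topology m) U}"
      if "i \<in> {1..}" "A \<subseteq> {..<m}" for i :: nat and A
    proof -
      have "openin (Sigma_topology m) {f \<in> topspace (Sigma_topology m). f i \<in> A}"
        by (rule openin_continuous_map_preimage[where Y="discrete_topology {..<m}"])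
          (use that in \<open>auto simp: Sigma_topology_def intro: continuous_map_product_projection\<close>)
      then show ?thesis by (auto simp: topspace_Sigma_topology)
    qed
    then show "{{f \<in> Sigma_space m. f i \<in> A} |i A. i \<in> {1..} \<and> A \<in> sets (count_space {..<m})}
        \<subseteq> sigma_sets (Sigma_space m) {U. openin (Sigma_topology m) U}"
      by auto
  qed
qed

lemma root_exponent_unique:
  assumes q: "2 \<le> q" and i: "i \<in> roots q" "i' \<in> roots q" and eq: "i * q ^ j = i' * q ^ j'"
  shows "i = i'" "j = j'"
proof -
  have *: "\<not> j < j'" if "i \<in> roots q" "i' \<in> roots q" "i * q ^ j = i' * q ^ j'" for i i' j j'
  proof
    assume "j < j'"
    then have "q ^ j' = q ^ j * q ^ (j' - j)" by (simp flip: power_add)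
    then have "i = i' * q ^ (j' - j)" using that(3) q by (simp add: mult.assoc mult.left_commute)
    moreover have "q dvd q ^ (j' - j)" using \<open>j < j'\<close> by (simp add: dvd_power)
    ultimately have "q dvd i" using dvd_mult by metis
    then show False using that(1) by (simp add: roots_def)
  qed
  show "j = j'" using *[OF i eq] *[OF i(2,1) eq[symmetric]] by simp
  then show "i = i'" using eq q by simp
qed

lemma root_exponent_ex:
  assumes q: "2 \<le> q" and k: "1 \<le> k"
  shows "\<exists>i\<in>roots q. \<exists>j. k = i * q ^ j"
  using k
proof (induction k rule: less_induct)
  case (less k)
  show ?case
  proof (cases "q dvd k")
    case False
    then show ?thesis using less.prems by (intro bexI[of _ k] exI[of _ 0]) (auto simp: roots_def)
  next
    case True
    then obtain l where l: "k = q * l" by auto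
    have "1 \<le> l" "l < k" using l less.prems q by auto
    then obtain i j where "i \<in> roots q" "l = i * q ^ j" using less.IH by blast
    then show ?thesis using l by (intro bexI[of _ i] exI[of _ "Suc j"]) auto
  qed
qed

lemma root_of_eq: "2 \<le> q \<Longrightarrow> i \<in> roots q \<Longrightarrow> root_of q (i * q ^ j) = i"
  unfolding root_of_def by (rule the_equality) (use root_exponent_unique(1) in blast)+

lemma exponent_of_eq: "2 \<le> q \<Longrightarrow> i \<in> roots q \<Longrightarrow> exponent_of q (i * q ^ j) = j"
  unfolding exponent_of_def by (rule the_equality) (use root_exponent_unique(2) in blast)+

lemma root_of_mem: "2 \<le> q \<Longrightarrow> 1 \<le> k \<Longrightarrow> root_of q k \<in> roots q"
  using root_exponent_ex[of q k] by (auto simp: root_of_eq)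

lemma root_exponent_decomp:
  "2 \<le> q \<Longrightarrow> 1 \<le> k \<Longrightarrow> k = root_of q k * q ^ exponent_of q k"
  using root_exponent_ex[of q k] by (auto simp: root_of_eq exponent_of_eq)

lemma restr_assemble:
  assumes "2 \<le> q" "i \<in> roots q" "y i \<in> Sigma_space m"
  shows "restr q i (assemble q y) = y i"
proof
  fix n
  have "1 \<le> i * q ^ (n - 1)" using assms by (auto simp: roots_def Suc_le_eq)
  then show "restr q i (assemble q y) n = y i n"
    using assms by (auto simp: restr_def assemble_def root_of_eq exponent_of_eq Sigma_space_def PiE_def extensional_def)
qed

lemma measurable_assemble:
  assumes q: "2 \<le> q" and s: "sets \<mu> = sets (Sigma_borel m)"
  shows "assemble q \<in> measurable (\<Pi>\<^sub>M i\<in>roots q. \<mu>) (Sigma_borel m)"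
proof -
  have "assemble q \<in> measurable (\<Pi>\<^sub>M i\<in>roots q. \<mu>) (\<Pi>\<^sub>M n\<in>{1..}. count_space {..<m})"
    unfolding assemble_def
  proof (rule measurable_restrict)
    fix k :: nat assume k: "k \<in> {1..}"
    have 1: "(\<lambda>y. y (root_of q k)) \<in> measurable (\<Pi>\<^sub>M i\<in>roots q. \<mu>) \<mu>"
      using k by (intro measurable_component_singleton root_of_mem q) auto
    have 2: "(\<lambda>x. x (exponent_of q k + 1)) \<in> measurable \<mu> (count_space {..<m})"
      unfolding measurable_cong_sets[OF s[unfolded sets_Sigma_borel] refl]
      by (intro measurable_component_singleton) auto
    show "(\<lambda>y. y (root_of q k) (exponent_of q k + 1)) \<in> measurable (\<Pi>\<^sub>M i\<in>roots q. \<mu>) (count_space {..<m})"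
      using measurable_compose[OF 1 2] .
  qed
  then show ?thesis by (simp add: measurable_cong_sets[OF refl sets_Sigma_borel])
qed

lemma prob_space_telescopic:
  assumes "2 \<le> q" "prob_space \<mu>" "sets \<mu> = sets (Sigma_borel m)"
  shows "prob_space (telescopic m q \<mu>)"
  unfolding telescopic_def
  by (intro prob_space.prob_space_distr prob_space_PiM measurable_assemble assms)

lemma card_exponents:
  fixes i n q :: nat
  assumes "2 \<le> q" "1 \<le> i"
  shows "i * q ^ j \<le> n \<longleftrightarrow> j < card {j. i * q ^ j \<le> n}"
proof -
  have fin: "finite {j. i * q ^ j \<le> n}"
  proof (rule finite_subset)
    show "{j. i * q ^ j \<le> n} \<subseteq> {..n}"
    proof
      fix j assume "j \<in> {j. i * q ^ j \<le> n}"
      moreover have "j < q ^ j" using assms by (intro power_gt_expt) auto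
      moreover have "q ^ j \<le> i * q ^ j" using assms by auto
      ultimately show "j \<in> {..n}" unfolding mem_Collect_eq atMost_iff by linarith
    qed
  qed auto
  have mono: "i * q ^ j \<le> i * q ^ j'" if "j \<le> j'" for j j'
    using that assms by (intro mult_le_mono2 power_increasing) auto
  show ?thesis
  proof
    assume "i * q ^ j \<le> n"
    then have "{..j} \<subseteq> {j. i * q ^ j \<le> n}" using le_trans[OF mono] by auto
    from card_mono[OF fin this] show "j < card {j. i * q ^ j \<le> n}" by simp
  next
    assume *: "j < card {j. i * q ^ j \<le> n}"
    show "i * q ^ j \<le> n"
    proof (rule ccontr)
      assume "\<not> i * q ^ j \<le> n"
      then have "{j. i * q ^ j \<le> n} \<subseteq> {..<j}" using le_trans[OF mono] by (auto simp flip: not_le)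
      from card_mono[OF _ this] * show False by simp
    qed
  qed
qed

(* The number of letters of u_1...u_n with index in {i * q^j | j \<ge> 0} is card {j. i * q^j \<le> n}. *)
lemma telescopic_cylinder:
  assumes q: "2 \<le> q" and p: "prob_space \<mu>" and s: "sets \<mu> = sets (Sigma_borel m)"
  shows "measure (telescopic m q \<mu>) (cylinder m n u) =
           (\<Prod>i\<in>{i \<in> roots q. i \<le> n}. measure \<mu> (cylinder m (card {j. i * q ^ j \<le> n}) (restr q i u)))"
proof -
  let ?P = "\<Pi>\<^sub>M i\<in>roots q. \<mu>" and ?J = "{i \<in> roots q. i \<le> n}"
  let ?E = "\<lambda>i. cylinder m (card {j. i * q ^ j \<le> n}) (restr q i u)"
  have sp: "space \<mu> = Sigma_space m" using sets_eq_imp_space_eq[OF s] by (simp add: space_Sigma_borel)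
  have cyl: "cylinder m a v \<in> sets (Sigma_borel m)" for a v
    using cylinder_in_PiM by (simp add: sets_Sigma_borel)
  interpret product_prob_space "\<lambda>_. \<mu>" "roots q"
    using p by (intro product_prob_space.intro product_prob_space_axioms.intro product_sigma_finite.intro prob_space_imp_sigma_finite)
  have "measure (telescopic m q \<mu>) (cylinder m n u) = measure ?P (assemble q -` cylinder m n u \<inter> space ?P)"
    unfolding telescopic_def by (rule measure_distr[OF measurable_assemble[OF q s] cyl])
  also have "assemble q -` cylinder m n u \<inter> space ?P = prod_emb (roots q) (\<lambda>_. \<mu>) ?J (Pi\<^sub>E ?J ?E)"
  proof (intro equalityI subsetI)
    fix y assume y: "y \<in> assemble q -` cylinder m n u \<inter> space ?P"
    then have yi: "y i \<in> Sigma_space m" if "i \<in> roots q" for i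
      using that by (auto simp: space_PiM sp)
    have "y i \<in> ?E i" if i: "i \<in> roots q" for i
    proof -
      have "y i l = restr q i u l" if l: "1 \<le> l" "l \<le> card {j. i * q ^ j \<le> n}" for l
      proof -
        have "i * q ^ (l - 1) \<le> n" using card_exponents[OF q, of i "l-1" n] i l by (auto simp: roots_def)
        moreover have "1 \<le> i * q ^ (l - 1)" using i q by (auto simp: roots_def Suc_le_eq)
        ultimately have "assemble q y (i * q ^ (l - 1)) = u (i * q ^ (l - 1))"
          using y by (auto simp: cylinder_def)
        then have "restr q i (assemble q y) l = restr q i u l" using l by (auto simp: restr_def)
        then show ?thesis using restr_assemble[where y=y and m=m] q i yi by simp
      qed
      then show ?thesis using yi[OF i] by (auto simp: cylinder_def)
    qed
    then show "y \<in> prod_emb (roots q) (\<lambda>_. \<mu>) ?J (Pi\<^sub>E ?J ?E)"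
      using y by (auto simp: prod_emb_def space_PiM)
  next
    fix y assume y: "y \<in> prod_emb (roots q) (\<lambda>_. \<mu>) ?J (Pi\<^sub>E ?J ?E)"
    then have ysp: "y \<in> space ?P" and yE: "\<And>i. i \<in> ?J \<Longrightarrow> y i \<in> ?E i"
      by (auto simp: prod_emb_def space_PiM)
    have "assemble q y \<in> Sigma_space m"
      using measurable_space[OF measurable_assemble[OF q s] ysp] by (simp add: space_Sigma_borel)
    moreover have "assemble q y k = u k" if k: "1 \<le> k" "k \<le> n" for k
    proof -
      let ?i = "root_of q k" and ?j = "exponent_of q k"
      have i: "?i \<in> roots q" using root_of_mem q k by auto
      have d: "?i * q ^ ?j = k" using root_exponent_decomp[of q k] q k by simp
      have "1 \<le> q ^ ?j" using q by auto
      then have "?i * 1 \<le> ?i * q ^ ?j" by (rule mult_le_mono2)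
      then have le: "?i \<le> n" using d k by linarith
      have "?j < card {j. ?i * q ^ j \<le> n}"
        using card_exponents[OF q, of ?i ?j n] i d k by (simp add: roots_def)
      then have "y ?i (?j + 1) = restr q ?i u (?j + 1)"
        using yE[of ?i] i le by (auto simp: cylinder_def)
      then show ?thesis using k d by (simp add: assemble_def restr_def)
    qed
    ultimately show "y \<in> assemble q -` cylinder m n u \<inter> space ?P"
      using ysp by (auto simp: cylinder_def)
  qed
  also have "measure ?P \<dots> = (\<Prod>i\<in>?J. measure \<mu> (?E i))"
    by (rule measure_PiM_emb) (auto simp: s cyl)
  finally show ?thesis .
qed

end

theory Submission
  imports Defs "HOL-Library.Discrete_Functions"
begin

text \<open>
  Write \<open>X\<^sub>k\<close> for the centred variable \<open>F\<^sub>k(x|\<Lambda>) - E F\<^sub>k\<close>, where \<open>\<Lambda>\<close> is the progression through \<open>k\<close>,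
  and \<open>e(k)\<close> for the exponent of \<open>k\<close>, so that \<open>k = i q\<^sup>e\<close> with \<open>q\<close> not dividing \<open>i\<close>.
  Variables with distinct roots are independent, hence orthogonal; for a common root the
  hypothesis gives \<open>E X\<^sub>k X\<^sub>l \<le> C w\<^sub>k w\<^sub>l\<close>, where \<open>w\<^sub>k = s\<^bsup>e(k)\<^esup>\<close> and \<open>s\<close> is the square root of \<open>\<eta>\<close>.
  Replacing \<open>\<eta>\<close> by \<open>max \<eta> 2\<close>, which is still below \<open>q\<^bsup>3/2\<^esup>\<close>, makes \<open>w\<close> grow geometrically along
  each progression: the sum of \<open>w\<^sub>l\<close> over the \<open>l \<le> k\<close> with the root of \<open>k\<close> is then at most a
  constant times its last term \<open>w\<^sub>k\<close>. Hence \<open>E S\<^sub>n\<^sup>2\<close>, for \<open>S\<^sub>n = X\<^sub>1 + \<dots> + X\<^sub>n\<close>, is at most a constant times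
  the sum of \<open>w\<^sub>k\<^sup>2\<close> over \<open>k \<le> n\<close>, as if all the variables were orthogonal.

  Choose \<open>1 < \<gamma> < 3/2\<close> with \<open>s\<^sup>2 < q\<^sup>\<gamma>\<close>. Splitting \<open>k\<close> into root and power, the series with terms
  \<open>w\<^sub>k\<^sup>2 k\<^bsup>-\<gamma>\<^esup>\<close> is dominated by a zeta series times a geometric one of ratio \<open>s\<^sup>2 / q\<^sup>\<gamma>\<close>, so it converges
  (\<open>summable_exponent_weights\<close>). Two facts follow: \<open>E S\<^sub>n\<^sup>2 = O(n\<^sup>\<gamma>)\<close> (\<open>second_moment_growth\<close>), and the
  series with terms \<open>E X\<^sub>k\<^sup>2 k\<^bsup>-3/2\<^esup>\<close> converges.

  They suffice for the strong law (\<open>strong_law_of_second_moments\<close>), and \<open>3/2\<close> is the threshold for both.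
  The first gives \<open>E (S\<^sub>N / N)\<^sup>2 = O(k\<^bsup>2\<gamma>-4\<^esup>)\<close> at \<open>N = k\<^sup>2\<close>, which is summable, so that the averages tend to
  zero along the squares. Between consecutive squares there are only about \<open>2 k\<close> indices, and the
  Cauchy-Schwarz inequality with the second fact controls the increments there
  (\<open>averages_from_squares\<close>).
\<close>

section \<open>A strong law from second moments\<close>

text \<open>
  For \<open>k\<^sup>2 \<le> n < (k+1)\<^sup>2\<close> the block from \<open>k\<^sup>2\<close> to \<open>n\<close> has at most \<open>2k \<le> 2n\<^bsup>1/2\<^esup>\<close> terms. By Cauchy-Schwarz the
  square of its sum is at most \<open>2n\<^bsup>1/2\<^esup>\<close> times its sum of squares, and the latter is at most \<open>n\<^bsup>3/2\<^esup>\<close> times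
  a tail of the convergent series. The product is \<open>n\<^sup>2\<close> times a quantity tending to zero; this is
  why the exponent in the series is \<open>3/2\<close>.
\<close>
lemma averages_from_squares:
  fixes x :: "nat \<Rightarrow> real"
  assumes sub: "(\<lambda>k. (\<Sum>l=1..k\<^sup>2. x l) / real (k\<^sup>2)) \<longlonglongrightarrow> 0"
    and summ: "summable (\<lambda>l. (x l)\<^sup>2 * real l powr (- 3 / 2))"
  shows "(\<lambda>n. (\<Sum>l=1..n. x l) / real n) \<longlonglongrightarrow> 0"
proof -
  define u where "u l = (x l)\<^sup>2 * real l powr (- 3 / 2)" for l
  define S where "S n = (\<Sum>l=1..n. x l)" for n
  define R where "R n = suminf u - sum u {..n}" for n
  have u: "summable u" "\<And>l. 0 \<le> u l" using summ by (simp_all add: u_def[abs_def])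
  have R: "R \<longlonglongrightarrow> 0"
    using tendsto_diff[OF tendsto_const summable_LIMSEQ'[OF u(1)], of "suminf u"]
    by (simp add: R_def[abs_def])
  have sum_le: "sum u {k<..n} \<le> R k" if "k \<le> n" for k n
  proof -
    have "sum u {..n} = sum u {..k} + sum u {k<..n}"
      using that by (subst sum.union_disjoint[symmetric]) (auto intro!: sum.cong)
    moreover have "sum u {..n} \<le> suminf u" using u by (intro sum_le_suminf) auto
    ultimately show ?thesis by (simp add: R_def)
  qed
  have gap: "\<bar>S n - S (k\<^sup>2)\<bar> \<le> real n * sqrt (2 * R (k\<^sup>2))"
    if k: "k\<^sup>2 \<le> n" "n < (Suc k)\<^sup>2" and n: "1 \<le> n" for n k
  proof -
    have eq: "S n - S (k\<^sup>2) = sum x {k\<^sup>2<..n}"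
    proof -
      have "S n = S (k\<^sup>2) + sum x {k\<^sup>2<..n}"
        unfolding S_def using k by (subst sum.union_disjoint[symmetric]) (auto intro!: sum.cong)
      then show ?thesis by simp
    qed
    have card: "real (card {k\<^sup>2<..n}) \<le> 2 * real k"
    proof -
      have "card {k\<^sup>2<..n} \<le> 2 * k" using k by (simp add: power2_eq_square)
      then show ?thesis by linarith
    qed
    have kn: "real k \<le> real n powr (1 / 2)"
      using k(1) by (simp add: powr_half_sqrt real_le_rsqrt flip: of_nat_power)
    have "(x l)\<^sup>2 \<le> u l * real n powr (3 / 2)" if "l \<in> {k\<^sup>2<..n}" for l
    proof -
      have l: "0 < l" "l \<le> n" using that by auto
      have "(x l)\<^sup>2 = u l * real l powr (3 / 2)"
        using l by (simp add: u_def mult.assoc flip: powr_add)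
      also have "\<dots> \<le> u l * real n powr (3 / 2)"
        using l u(2) by (intro mult_left_mono powr_mono2) auto
      finally show ?thesis .
    qed
    then have "(\<Sum>l\<in>{k\<^sup>2<..n}. (x l)\<^sup>2) \<le> (\<Sum>l\<in>{k\<^sup>2<..n}. u l * real n powr (3 / 2))"
      by (rule sum_mono)
    also have "\<dots> \<le> R (k\<^sup>2) * real n powr (3 / 2)"
      unfolding sum_distrib_right[symmetric] using sum_le[OF k(1)] by (intro mult_right_mono) auto
    finally have squares: "(\<Sum>l\<in>{k\<^sup>2<..n}. (x l)\<^sup>2) \<le> R (k\<^sup>2) * real n powr (3 / 2)" .
    have "(S n - S (k\<^sup>2))\<^sup>2 \<le> (\<Sum>l\<in>{k\<^sup>2<..n}. (x l)\<^sup>2) * real (card {k\<^sup>2<..n})"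
      unfolding eq by (rule sum_squared_le_sum_of_squares)
    also have "\<dots> \<le> (R (k\<^sup>2) * real n powr (3 / 2)) * (2 * real n powr (1 / 2))"
      using squares card kn by (intro mult_mono order_trans[OF _ squares] sum_nonneg) auto
    also have "\<dots> = 2 * R (k\<^sup>2) * (real n powr (3 / 2) * real n powr (1 / 2))" by simp
    also have "real n powr (3 / 2) * real n powr (1 / 2) = (real n)\<^sup>2"
      using n by (simp flip: powr_add)
    finally have "\<bar>S n - S (k\<^sup>2)\<bar> \<le> sqrt (2 * R (k\<^sup>2) * (real n)\<^sup>2)"
      using real_le_rsqrt by fastforce
    then show ?thesis by (simp add: real_sqrt_mult mult.commute)
  qed
  have lim_sqrt: "filterlim floor_sqrt sequentially sequentially"
    unfolding filterlim_at_top
    using eventually_sequentially le_floor_sqrt_iff by blast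
  have bnd: "(\<lambda>k. \<bar>S (k\<^sup>2) / real (k\<^sup>2)\<bar> + sqrt (2 * R (k\<^sup>2))) \<longlonglongrightarrow> 0"
  proof -
    have "(\<lambda>k. R (k\<^sup>2)) \<longlonglongrightarrow> 0"
      by (rule filterlim_compose[OF R]) (auto intro!: filterlim_subseq strict_monoI simp: power_strict_mono)
    then have "(\<lambda>k. sqrt (2 * R (k\<^sup>2))) \<longlonglongrightarrow> 0"
      by (auto intro!: tendsto_eq_intros)
    from tendsto_add[OF tendsto_rabs_zero[OF sub] this] show ?thesis by (simp add: S_def)
  qed
  show ?thesis
  proof (rule Lim_null_comparison)
    show "(\<lambda>n. \<bar>S ((floor_sqrt n)\<^sup>2) / real ((floor_sqrt n)\<^sup>2)\<bar> + sqrt (2 * R ((floor_sqrt n)\<^sup>2))) \<longlonglongrightarrow> 0"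
      by (rule filterlim_compose[OF bnd lim_sqrt])
    show "\<forall>\<^sub>F n in sequentially. norm ((\<Sum>l=1..n. x l) / real n) \<le>
        \<bar>S ((floor_sqrt n)\<^sup>2) / real ((floor_sqrt n)\<^sup>2)\<bar> + sqrt (2 * R ((floor_sqrt n)\<^sup>2))"
      using eventually_ge_at_top[of 1]
    proof eventually_elim
      case (elim n)
      define k where "k = floor_sqrt n"
      have k: "k\<^sup>2 \<le> n" "n < (Suc k)\<^sup>2" "1 \<le> k"
        unfolding k_def using elim Suc_floor_sqrt_power2_gt by (auto simp: le_floor_sqrt_iff)
      have "\<bar>S n\<bar> \<le> \<bar>S (k\<^sup>2)\<bar> + \<bar>S n - S (k\<^sup>2)\<bar>" by linarith
      then have "\<bar>S n\<bar> / real n \<le> \<bar>S (k\<^sup>2)\<bar> / real n + \<bar>S n - S (k\<^sup>2)\<bar> / real n"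
        by (simp add: divide_right_mono flip: add_divide_distrib)
      also have "\<bar>S n - S (k\<^sup>2)\<bar> / real n \<le> sqrt (2 * R (k\<^sup>2))"
        using gap[OF k(1,2) elim] elim by (simp add: divide_le_eq mult.commute)
      also have "\<bar>S (k\<^sup>2)\<bar> / real n \<le> \<bar>S (k\<^sup>2)\<bar> / real (k\<^sup>2)"
        using k elim by (intro divide_left_mono) (auto simp flip: of_nat_power)
      finally show ?case by (simp add: S_def k_def)
    qed
  qed
qed

text \<open>
  Monotone convergence: the sum of the series has finite integral, so it is finite almost everywhere.
\<close>
lemma AE_summable_of_summable_integrals:
  fixes f :: "nat \<Rightarrow> 'a \<Rightarrow> real"
  assumes int: "\<And>i. integrable M (f i)" and nn: "\<And>i x. 0 \<le> f i x"
    and summ: "summable (\<lambda>i. integral\<^sup>L M (f i))"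
  shows "AE x in M. summable (\<lambda>i. f i x)"
proof -
  have [measurable]: "\<And>i. f i \<in> borel_measurable M" using int by auto
  have "(\<integral>\<^sup>+x. (\<Sum>i. ennreal (f i x)) \<partial>M) = (\<Sum>i. \<integral>\<^sup>+x. ennreal (f i x) \<partial>M)"
    by (rule nn_integral_suminf) auto
  also have "\<dots> = (\<Sum>i. ennreal (integral\<^sup>L M (f i)))"
    using int nn by (simp add: nn_integral_eq_integral)
  also have "\<dots> \<noteq> top"
    using summ nn by (intro ennreal_suminf_neq_top) auto
  finally have "AE x in M. (\<Sum>i. ennreal (f i x)) \<noteq> \<infinity>"
    by (intro nn_integral_PInf_AE) auto
  then show ?thesis
    by eventually_elim (auto intro: summable_suminf_not_top nn)
qed

lemma integrable_mult_of_square_integrable: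
  fixes f g :: "'a \<Rightarrow> real"
  assumes [measurable]: "f \<in> borel_measurable M" "g \<in> borel_measurable M"
    and "integrable M (\<lambda>x. (f x)\<^sup>2)" "integrable M (\<lambda>x. (g x)\<^sup>2)"
  shows "integrable M (\<lambda>x. f x * g x)"
proof (rule Bochner_Integration.integrable_bound)
  show "integrable M (\<lambda>x. (f x)\<^sup>2 + (g x)\<^sup>2)" using assms by simp
  have "\<bar>a * b\<bar> \<le> a\<^sup>2 + b\<^sup>2" for a b :: real
    using sum_squares_bound[of "\<bar>a\<bar>" "\<bar>b\<bar>"] mult_nonneg_nonneg[OF abs_ge_zero[of a] abs_ge_zero[of b]]
    unfolding abs_mult power2_abs by linarith
  then show "AE x in M. norm (f x * g x) \<le> norm ((f x)\<^sup>2 + (g x)\<^sup>2)"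
    by (intro AE_I2) (simp add: abs_mult)
qed simp

text \<open>
  Sparse times with an interpolation. Along the squares the variance bound alone makes
  \<open>(S\<^sub>N / N)\<^sup>2\<close> summable almost everywhere, since \<open>2\<gamma> - 4 < -1\<close>; the individual second moments are
  needed for the gaps between squares.
\<close>
lemma strong_law_of_second_moments:
  fixes X :: "nat \<Rightarrow> 'a \<Rightarrow> real"
  assumes meas: "\<And>k. 1 \<le> k \<Longrightarrow> X k \<in> borel_measurable M"
    and sq: "\<And>k. 1 \<le> k \<Longrightarrow> integrable M (\<lambda>\<omega>. (X k \<omega>)\<^sup>2)"
    and var: "\<And>n. (LINT \<omega>|M. (\<Sum>k=1..n. X k \<omega>)\<^sup>2) \<le> K * real n powr \<gamma>"
    and \<gamma>: "\<gamma> < 3 / 2"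
    and summ: "summable (\<lambda>k. (LINT \<omega>|M. (X k \<omega>)\<^sup>2) * real k powr (- 3 / 2))"
  shows "AE \<omega> in M. (\<lambda>n. (\<Sum>k=1..n. X k \<omega>) / real n) \<longlonglongrightarrow> 0"
proof -
  have int: "integrable M (\<lambda>\<omega>. (\<Sum>k=1..n. X k \<omega>)\<^sup>2)" for n
    unfolding power2_eq_square sum_product
    by (intro Bochner_Integration.integrable_sum integrable_mult_of_square_integrable meas sq) auto
  let ?f = "\<lambda>k \<omega>. ((\<Sum>l=1..k\<^sup>2. X l \<omega>) / real (k\<^sup>2))\<^sup>2"
  have sub: "AE \<omega> in M. summable (\<lambda>k. ?f k \<omega>)"
  proof (rule AE_summable_of_summable_integrals)
    show "integrable M (?f k)" for k
      using int[of "k\<^sup>2"] by (simp add: power_divide)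
    show "summable (\<lambda>k. integral\<^sup>L M (?f k))"
    proof (rule summable_comparison_test')
      show "summable (\<lambda>k. K * real k powr (2 * \<gamma> - 4))"
        using \<gamma> by (intro summable_mult) (simp add: summable_real_powr_iff)
      fix k :: nat assume k: "1 \<le> k"
      have "integral\<^sup>L M (?f k) = (LINT \<omega>|M. (\<Sum>l=1..k\<^sup>2. X l \<omega>)\<^sup>2) / real k ^ 4"
        by (simp add: power_divide)
      also have "\<dots> \<le> K * real (k\<^sup>2) powr \<gamma> / real k ^ 4"
        using var[of "k\<^sup>2"] by (intro divide_right_mono) auto
      also have "\<dots> = K * real k powr (2 * \<gamma> - 4)"
      proof -
        have "real (k\<^sup>2) powr \<gamma> = real k powr (2 * \<gamma>)"
          using k by (simp add: powr_powr flip: powr_numeral)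
        then show ?thesis using k by (simp add: powr_diff flip: powr_numeral)
      qed
      finally show "norm (integral\<^sup>L M (?f k)) \<le> K * real k powr (2 * \<gamma> - 4)"
        by simp
    qed
  qed simp
  have single: "AE \<omega> in M. summable (\<lambda>k. (X k \<omega>)\<^sup>2 * real k powr (- 3 / 2))"
  proof (rule AE_summable_of_summable_integrals)
    show "integrable M (\<lambda>\<omega>. (X k \<omega>)\<^sup>2 * real k powr (- 3 / 2))" for k
      using sq[of k] by (cases "k = 0") auto
    have "(LINT \<omega>|M. (X k \<omega>)\<^sup>2 * real k powr (- 3 / 2)) = (LINT \<omega>|M. (X k \<omega>)\<^sup>2) * real k powr (- 3 / 2)" for k
      by simp
    then show "summable (\<lambda>k. LINT \<omega>|M. (X k \<omega>)\<^sup>2 * real k powr (- 3 / 2))"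
      using summ by presburger
  qed simp
  from sub single show ?thesis
  proof eventually_elim
    case (elim \<omega>)
    have "(\<lambda>k. ?f k \<omega>) \<longlonglongrightarrow> 0" by (rule summable_LIMSEQ_zero[OF elim(1)])
    then have "(\<lambda>k. (\<Sum>l=1..k\<^sup>2. X l \<omega>) / real (k\<^sup>2)) \<longlonglongrightarrow> 0"
      by (simp only: power_tendsto_0_iff zero_less_numeral)
    then show ?case by (rule averages_from_squares[OF _ elim(2)])
  qed
qed

section \<open>Weights that depend on the power of \<open>q\<close> in an index\<close>

text \<open>
  The map taking \<open>k = i q\<^sup>j\<close> to the pair \<open>(i, j)\<close> is injective and turns the term into
  \<open>i\<^bsup>-\<gamma>\<^esup> (a / q\<^sup>\<gamma>)\<^sup>j\<close>, so the partial sums are bounded by a product of a zeta series and a geometric series.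
\<close>
lemma summable_exponent_weights:
  assumes q: "2 \<le> q" and a: "0 < a" "a < real q powr \<gamma>" and \<gamma>: "1 < \<gamma>"
  shows "summable (\<lambda>k. a ^ exponent_of q k * real k powr - \<gamma>)"
proof -
  define r where "r = a / real q powr \<gamma>"
  have r: "0 < r" "r < 1" using a q by (auto simp: r_def)
  let ?g = "\<lambda>(i, j). real i powr - \<gamma> * r ^ j"
  let ?h = "\<lambda>k. (root_of q k, exponent_of q k)"
  define B where "B = (\<Sum>i. real i powr - \<gamma>) * (\<Sum>j. r ^ j)"
  have s1: "summable (\<lambda>i. real i powr - \<gamma>)" using \<gamma> by (simp add: summable_real_powr_iff)
  have s2: "summable (\<lambda>j. r ^ j)" using r by (simp add: summable_geometric)
  show ?thesis
  proof (rule summableI_nonneg_bounded)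
    show "0 \<le> a ^ exponent_of q k * real k powr - \<gamma>" for k using a by simp
    fix n
    have val: "a ^ exponent_of q k * real k powr - \<gamma> = ?g (?h k)" if k: "1 \<le> k" for k
    proof -
      have "real k = real (root_of q k) * real q ^ exponent_of q k"
        using root_exponent_decomp[OF q k] by (metis of_nat_mult of_nat_power)
      then have "real k powr - \<gamma> = real (root_of q k) powr - \<gamma> * (real q powr - \<gamma>) ^ exponent_of q k"
        using q by (simp add: powr_mult powr_powr mult.commute flip: powr_realpow)
      then show ?thesis
        by (simp add: r_def power_mult_distrib power_divide powr_minus field_simps)
    qed
    have inj: "inj_on ?h {1..<n}"
      by (rule inj_onI) (metis Pair_inject atLeastLessThan_iff q root_exponent_decomp)
    have dom: "?h k \<in> {..<n} \<times> {..<n}" if k: "k \<in> {1..<n}" for k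
    proof -
      have k1: "1 \<le> k" using k by auto
      have "root_of q k \<le> k"
        using root_exponent_decomp[OF q k1] q by (metis dvd_imp_le dvd_triv_left k1 less_eq_Suc_le One_nat_def)
      moreover have "exponent_of q k < q ^ exponent_of q k" using q by (intro power_gt_expt) auto
      moreover have "q ^ exponent_of q k \<le> k"
        using root_exponent_decomp[OF q k1] by (metis dvd_imp_le dvd_triv_right k1 less_eq_Suc_le One_nat_def)
      ultimately show ?thesis using k by auto
    qed
    have "(\<Sum>k<n. a ^ exponent_of q k * real k powr - \<gamma>) = (\<Sum>k\<in>{1..<n}. a ^ exponent_of q k * real k powr - \<gamma>)"
      by (intro sum.mono_neutral_right) (auto simp: not_le)
    also have "\<dots> = (\<Sum>k\<in>{1..<n}. ?g (?h k))"
      by (intro sum.cong refl val) auto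
    also have "\<dots> = sum ?g (?h ` {1..<n})"
      by (subst sum.reindex[OF inj]) simp
    also have "\<dots> \<le> sum ?g ({..<n} \<times> {..<n})"
      using dom r by (intro sum_mono2) auto
    also have "\<dots> = (\<Sum>i<n. real i powr - \<gamma>) * (\<Sum>j<n. r ^ j)"
      by (simp add: sum_product sum.cartesian_product)
    also have "\<dots> \<le> B"
      unfolding B_def using r s1 s2 by (intro mult_mono sum_le_suminf suminf_nonneg sum_nonneg) auto
    finally show "(\<Sum>k<n. a ^ exponent_of q k * real k powr - \<gamma>) \<le> B" .
  qed
qed

text \<open>
  By symmetry only the pairs \<open>l \<le> k\<close> matter, at the cost of a factor two. For fixed \<open>k\<close> the admissible
  \<open>l\<close> have distinct exponents, none above that of \<open>k\<close>, so the inner sum is part of a geometric sum with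
  ratio \<open>s > 1\<close>, which is comparable to its largest term. The off-diagonal pairs are thus absorbed by
  the diagonal.
\<close>
lemma sum_same_root_le:
  fixes s :: real
  assumes q: "2 \<le> q" and s: "1 < s"
  shows "(\<Sum>k=1..n. \<Sum>l=1..n. if root_of q k = root_of q l then s ^ (exponent_of q k + exponent_of q l) else 0)
           \<le> 2 * (s / (s - 1)) * (\<Sum>k=1..n. (s\<^sup>2) ^ exponent_of q k)"
proof -
  let ?e = "exponent_of q"
  let ?f = "\<lambda>k l. if root_of q k = root_of q l then s ^ (?e k + ?e l) else 0"
  \<comment> \<open>the sum over the part of the progression of \<open>k\<close> up to \<open>k\<close>\<close>
  have row: "(\<Sum>l=1..k. ?f k l) \<le> s / (s - 1) * (s\<^sup>2) ^ ?e k" if k: "1 \<le> k" for k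
  proof -
    have le: "?e l \<le> ?e k" if l: "1 \<le> l" "l \<le> k" "root_of q k = root_of q l" for l
    proof -
      have "root_of q k * q ^ ?e l \<le> root_of q k * q ^ ?e k" "0 < root_of q k"
        using l k root_exponent_decomp[OF q] by (metis, metis mult_is_0 gr0I not_one_le_zero)
      then show ?thesis using q by simp
    qed
    have "(\<Sum>l=1..k. ?f k l) = (\<Sum>l\<in>{l\<in>{1..k}. root_of q k = root_of q l}. s ^ ?e k * s ^ ?e l)"
      by (simp only: sum.inter_filter[OF finite_atLeastAtMost] power_add)
    also have "\<dots> = s ^ ?e k * (\<Sum>j\<in>?e ` {l\<in>{1..k}. root_of q k = root_of q l}. s ^ j)"
    proof -
      have "inj_on ?e {l\<in>{1..k}. root_of q k = root_of q l}"
        by (rule inj_onI) (metis (mono_tags, lifting) atLeastAtMost_iff mem_Collect_eq q root_exponent_decomp)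
      then show ?thesis by (simp add: sum.reindex sum_distrib_left)
    qed
    also have "\<dots> \<le> s ^ ?e k * (\<Sum>j\<le>?e k. s ^ j)"
      using le s by (intro mult_left_mono sum_mono2) auto
    also have "(\<Sum>j\<le>?e k. s ^ j) = (s ^ Suc (?e k) - 1) / (s - 1)"
      using s geometric_sum[of s "Suc (?e k)"] by (simp add: lessThan_Suc_atMost)
    also have "\<dots> \<le> s / (s - 1) * s ^ ?e k"
      using s by (simp add: field_simps)
    finally show ?thesis
      using s by (simp add: power2_eq_square power_mult_distrib mult_ac)
  qed
  have "(\<Sum>k=1..n. \<Sum>l=1..n. ?f k l)
      \<le> (\<Sum>k=1..n. \<Sum>l=1..n. (if l \<le> k then ?f k l else 0) + (if k \<le> l then ?f l k else 0))"
    using s by (intro sum_mono) (auto simp: add.commute)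
  also have "\<dots> = 2 * (\<Sum>k=1..n. \<Sum>l=1..n. if l \<le> k then ?f k l else 0)"
    unfolding sum.distrib by (subst (2) sum.swap) simp
  also have "(\<Sum>k=1..n. \<Sum>l=1..n. if l \<le> k then ?f k l else 0) = (\<Sum>k=1..n. \<Sum>l=1..k. ?f k l)"
  proof (rule sum.cong[OF refl])
    fix k assume k: "k \<in> {1..n}"
    have "(\<Sum>l=1..n. if l \<le> k then ?f k l else 0) = sum (?f k) {l \<in> {1..n}. l \<le> k}"
      by (rule sum.inter_filter[symmetric]) simp
    moreover have "{l \<in> {1..n}. l \<le> k} = {1..k}" using k by auto
    ultimately show "(\<Sum>l=1..n. if l \<le> k then ?f k l else 0) = (\<Sum>l=1..k. ?f k l)"
      by (simp only:)
  qed
  also have "\<dots> \<le> (\<Sum>k=1..n. s / (s - 1) * (s\<^sup>2) ^ ?e k)"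
    by (intro sum_mono row) auto
  finally show ?thesis by (simp add: sum_distrib_left mult.assoc)
qed

text \<open>
  Expanding the square leaves the pairs with a common root, which are reduced to the diagonal sum of
  \<open>(s\<^sup>2)\<^bsup>e(k)\<^esup>\<close> over \<open>k \<le> n\<close>. Each of its terms is at most \<open>n\<^sup>\<gamma>\<close> times the term of a convergent series,
  because \<open>1 \<le> (n / k)\<^sup>\<gamma>\<close>.
\<close>
lemma second_moment_growth:
  fixes X :: "nat \<Rightarrow> 'a \<Rightarrow> real"
  assumes q: "2 \<le> q"
    and meas: "\<And>k. 1 \<le> k \<Longrightarrow> X k \<in> borel_measurable M"
    and sq: "\<And>k. 1 \<le> k \<Longrightarrow> integrable M (\<lambda>\<omega>. (X k \<omega>)\<^sup>2)"
    and cross: "\<And>k l. 1 \<le> k \<Longrightarrow> 1 \<le> l \<Longrightarrow> (LINT \<omega>|M. X k \<omega> * X l \<omega>)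
        \<le> (if root_of q k = root_of q l then C * s ^ (exponent_of q k + exponent_of q l) else 0)"
    and C: "0 \<le> C" and s: "1 < s" "s\<^sup>2 < real q powr \<gamma>" and \<gamma>: "1 < \<gamma>"
  shows "\<exists>K. \<forall>n. (LINT \<omega>|M. (\<Sum>k=1..n. X k \<omega>)\<^sup>2) \<le> K * real n powr \<gamma>"
proof -
  let ?e = "exponent_of q"
  define W where "W = (\<Sum>k. (s\<^sup>2) ^ ?e k * real k powr - \<gamma>)"
  have summ: "summable (\<lambda>k. (s\<^sup>2) ^ ?e k * real k powr - \<gamma>)"
    using s by (intro summable_exponent_weights q \<gamma>) auto
  have weights: "(\<Sum>k=1..n. (s\<^sup>2) ^ ?e k) \<le> W * real n powr \<gamma>" for n
  proof -
    have "(\<Sum>k=1..n. (s\<^sup>2) ^ ?e k) \<le> (\<Sum>k=1..n. (s\<^sup>2) ^ ?e k * real k powr - \<gamma> * real n powr \<gamma>)"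
    proof (rule sum_mono)
      fix k assume k: "k \<in> {1..n}"
      have "1 = real k powr - \<gamma> * real k powr \<gamma>" using k by (simp flip: powr_add)
      also have "\<dots> \<le> real k powr - \<gamma> * real n powr \<gamma>"
        using k \<gamma> by (intro mult_left_mono powr_mono2) auto
      finally have "(s\<^sup>2) ^ ?e k * 1 \<le> (s\<^sup>2) ^ ?e k * (real k powr - \<gamma> * real n powr \<gamma>)"
        by (intro mult_left_mono) auto
      then show "(s\<^sup>2) ^ ?e k \<le> (s\<^sup>2) ^ ?e k * real k powr - \<gamma> * real n powr \<gamma>"
        by (simp add: mult.assoc)
    qed
    also have "\<dots> \<le> W * real n powr \<gamma>"
      unfolding sum_distrib_right[symmetric] W_def
      by (intro mult_right_mono sum_le_suminf summ) auto
    finally show ?thesis .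
  qed
  have "(LINT \<omega>|M. (\<Sum>k=1..n. X k \<omega>)\<^sup>2) \<le> C * (2 * (s / (s - 1))) * W * real n powr \<gamma>" for n
  proof -
    have "(LINT \<omega>|M. (\<Sum>k=1..n. X k \<omega>)\<^sup>2) = (LINT \<omega>|M. (\<Sum>k=1..n. \<Sum>l=1..n. X k \<omega> * X l \<omega>))"
      by (simp add: power2_eq_square sum_product)
    also have "\<dots> = (\<Sum>k=1..n. \<Sum>l=1..n. LINT \<omega>|M. X k \<omega> * X l \<omega>)"
      by (subst Bochner_Integration.integral_sum, (auto)[1]) 
        (auto intro!: Bochner_Integration.integrable_sum Bochner_Integration.integral_sum sum.cong
           integrable_mult_of_square_integrable meas sq)
    also have "\<dots> \<le> (\<Sum>k=1..n. \<Sum>l=1..n. if root_of q k = root_of q l then C * s ^ (?e k + ?e l) else 0)"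
      by (intro sum_mono cross) auto
    also have "\<dots> = C * (\<Sum>k=1..n. \<Sum>l=1..n. if root_of q k = root_of q l then s ^ (?e k + ?e l) else 0)"
      unfolding sum_distrib_left by (intro sum.cong refl) auto
    also have "\<dots> \<le> C * (2 * (s / (s - 1)) * (\<Sum>k=1..n. (s\<^sup>2) ^ ?e k))"
      by (intro mult_left_mono sum_same_root_le q s C)
    also have "\<dots> \<le> C * (2 * (s / (s - 1)) * (W * real n powr \<gamma>))"
      using s C by (intro mult_left_mono weights) auto
    finally show ?thesis by (simp only: mult.assoc)
  qed
  then show ?thesis by blast
qed

section \<open>Coordinates of an infinite product\<close>

lemma (in product_prob_space) integral_PiM_coordinate:
  fixes f :: "'a \<Rightarrow> 'b::{banach, second_countable_topology}"
  assumes i: "i \<in> I" and f: "f \<in> borel_measurable (M i)"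
  shows "(LINT y|PiM I M. f (y i)) = integral\<^sup>L (M i) f"
    and "integrable (PiM I M) (\<lambda>y. f (y i)) \<longleftrightarrow> integrable (M i) f"
proof -
  have co: "(\<lambda>y. y i) \<in> measurable (PiM I M) (M i)"
    using i by (rule measurable_component_singleton)
  show "(LINT y|PiM I M. f (y i)) = integral\<^sup>L (M i) f"
    using integral_distr[OF co f] PiM_component[OF i] by simp
  show "integrable (PiM I M) (\<lambda>y. f (y i)) \<longleftrightarrow> integrable (M i) f"
    using integrable_distr_eq[OF co f] PiM_component[OF i] by simp
qed

text \<open>
  The coordinates are independent because their joint distribution is the product measure itself;
  independence passes to functions of two distinct coordinates and factorises the expectation.
\<close>
lemma (in product_prob_space) integral_PiM_mult_coordinates:
  fixes f g :: "'a \<Rightarrow> real"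
  assumes ij: "i \<in> I" "j \<in> I" "i \<noteq> j"
    and f: "integrable (M i) f" and g: "integrable (M j) g"
  shows "(LINT y|PiM I M. f (y i) * g (y j)) = integral\<^sup>L (M i) f * integral\<^sup>L (M j) g"
proof -
  \<comment> \<open>one family of functions on \<open>{i, j}\<close>, as independence is a property of indexed families\<close>
  define Z where "Z k = (if k = i then f else g)" for k
  have Z: "Z k \<in> borel_measurable (M k)" "integrable (M k) (Z k)" if "k \<in> {i, j}" for k
    using that f g by (auto simp: Z_def)
  have "distr (PiM I M) (PiM I M) (\<lambda>y. \<lambda>k\<in>I. y k) = PiM I (\<lambda>k. distr (PiM I M) (M k) (\<lambda>y. y k))"
  proof -
    have "distr (PiM I M) (PiM I M) (\<lambda>y. \<lambda>k\<in>I. y k) = distr (PiM I M) (PiM I M) (\<lambda>y. y)"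
      by (rule distr_cong[OF refl refl]) (simp add: space_PiM PiE_def extensional_restrict)
    also have "\<dots> = PiM I M" by (rule distr_id2) (rule refl)
    also have "\<dots> = PiM I (\<lambda>k. distr (PiM I M) (M k) (\<lambda>y. y k))"
      by (rule PiM_cong[OF refl]) (rule PiM_component[symmetric])
    finally show ?thesis .
  qed
  moreover have "I \<noteq> {}" using ij by auto
  ultimately have "P.indep_vars M (\<lambda>k y. y k) I"
    by (intro iffD2[OF P.indep_vars_iff_distr_eq_PiM'] measurable_component_singleton)
  then have "P.indep_vars M (\<lambda>k y. y k) {i, j}"
    by (rule P.indep_vars_subset) (use ij in blast)
  then have "P.indep_vars (\<lambda>_. borel) (\<lambda>k y. Z k (y k)) {i, j}"
    by (rule P.indep_vars_compose2) (rule Z(1))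
  then have "(LINT y|PiM I M. (\<Prod>k\<in>{i, j}. Z k (y k))) = (\<Prod>k\<in>{i, j}. LINT y|PiM I M. Z k (y k))"
  proof (rule P.indep_vars_lebesgue_integral[rotated])
    fix k assume k: "k \<in> {i, j}"
    then have "k \<in> I" using ij by auto
    then show "integrable (PiM I M) (\<lambda>y. Z k (y k))"
      using integral_PiM_coordinate(2)[OF _ Z(1)[OF k]] Z(2)[OF k] by blast
  qed simp
  also have "\<dots> = (\<Prod>k\<in>{i, j}. integral\<^sup>L (M k) (Z k))"
  proof (rule prod.cong[OF refl])
    fix k assume k: "k \<in> {i, j}"
    then have "k \<in> I" using ij by auto
    then show "(LINT y|PiM I M. Z k (y k)) = integral\<^sup>L (M k) (Z k)"
      by (rule integral_PiM_coordinate(1)[OF _ Z(1)[OF k]])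
  qed
  finally show ?thesis using ij by (simp add: Z_def)
qed

lemma measurable_restr:
  assumes q: "2 \<le> q" and i: "i \<in> roots q" and s: "sets \<mu> = sets (Sigma_borel m)"
  shows "restr q i \<in> measurable (Sigma_borel m) \<mu>"
proof -
  have "restr q i \<in> measurable (\<Pi>\<^sub>M n\<in>{1..}. count_space {..<m}) (\<Pi>\<^sub>M n\<in>{1..}. count_space {..<m})"
    unfolding restr_def
    using q i by (intro measurable_restrict measurable_component_singleton) (auto simp: roots_def Suc_le_eq)
  then show ?thesis
    by (simp add: measurable_cong_sets[OF sets_Sigma_borel refl] measurable_cong_sets[OF refl s[unfolded sets_Sigma_borel]])
qed

section \<open>The strong law for telescopic product measures\<close>

text \<open>
  The argument takes place on the product over the roots, where \<open>X\<^sub>k\<close> is a function of the single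
  coordinate at the root of \<open>k\<close>. The conclusion is carried to the telescopic measure along \<open>assemble\<close>,
  which inverts the restrictions to the progressions.
\<close>
theorem theorem1p4:
  fixes m q :: nat
    and \<mu> :: "(nat \<Rightarrow> nat) measure"
    and F :: "nat \<Rightarrow> (nat \<Rightarrow> nat) \<Rightarrow> real"
    and C \<eta> :: real
  assumes "2 \<le> m" and "2 \<le> q"
    and "prob_space \<mu>" and "sets \<mu> = sets (Sigma_borel m)"
    and "\<And>k. 1 \<le> k \<Longrightarrow> F k \<in> borel_measurable \<mu>"
    and "\<And>k. 1 \<le> k \<Longrightarrow> integrable \<mu> (\<lambda>x. (F k x)\<^sup>2)"
    and "0 < C" and "0 < \<eta>" and "\<eta> < real q powr (3 / 2)"
    and "\<And>i j1 j2. 1 \<le> i \<Longrightarrow> \<not> q dvd i \<Longrightarrow>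
           cov \<mu> (F (i * q ^ j1)) (F (i * q ^ j2)) \<le> C * \<eta> powr (real (j1 + j2) / 2)"
  shows "AE x in telescopic m q \<mu>.
           (\<lambda>n. (1 / real n) *
                 (\<Sum>k=1..n. F k (restr q (root_of q k) x) - integral\<^sup>L \<mu> (F k)))
             \<longlonglongrightarrow> 0"
proof -
  note q = assms(2) and sets = assms(4) and F = assms(5) and F2 = assms(6) and C = assms(7)
  interpret \<mu>: prob_space \<mu> by (rule assms(3))
  interpret product_prob_space "\<lambda>_. \<mu>" "roots q"
    using assms(3) by (intro product_prob_space.intro product_prob_space_axioms.intro
        product_sigma_finite.intro prob_space_imp_sigma_finite)
  let ?P = "\<Pi>\<^sub>M i\<in>roots q. \<mu>"
  define G where "G k x = F k x - integral\<^sup>L \<mu> (F k)" for k x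
  define X where "X k y = G k (y (root_of q k))" for k and y :: "nat \<Rightarrow> nat \<Rightarrow> nat"
  have F1: "integrable \<mu> (F k)" if "1 \<le> k" for k
    using \<mu>.square_integrable_imp_integrable F F2 that by blast
  have G: "G k \<in> borel_measurable \<mu>" "integrable \<mu> (G k)" "integral\<^sup>L \<mu> (G k) = 0" if "1 \<le> k" for k
    using F[OF that] F1[OF that] by (auto simp: G_def[abs_def] \<mu>.prob_space)
  have G2: "integrable \<mu> (\<lambda>x. (G k x)\<^sup>2)" if "1 \<le> k" for k
    unfolding G_def power2_diff using F1[OF that] F2[OF that] by auto
  have root: "root_of q k \<in> roots q" if "1 \<le> k" for k using root_of_mem q that by simp
  have X: "X k \<in> borel_measurable ?P" if "1 \<le> k" for k
    unfolding X_def[abs_def]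
    by (rule measurable_compose[OF measurable_component_singleton[OF root[OF that]] G(1)[OF that]])
  have X2: "integrable ?P (\<lambda>y. (X k y)\<^sup>2)" if k: "1 \<le> k" for k
    using integral_PiM_coordinate(2)[OF root[OF k], of "\<lambda>x. (G k x)\<^sup>2"] G(1)[OF k] G2[OF k]
    by (simp add: X_def)
  \<comment> \<open>the maximum ensures \<open>s > 1\<close>; the value 2 is harmless because \<open>2 < q\<^bsup>3/2\<^esup>\<close>\<close>
  define s where "s = sqrt (max \<eta> 2)"
  have s2: "s\<^sup>2 = max \<eta> 2" by (simp add: s_def)
  have s: "1 < s" by (simp add: s_def)
  have cross: "(LINT y|?P. X k y * X l y)
      \<le> (if root_of q k = root_of q l then C * s ^ (exponent_of q k + exponent_of q l) else 0)"
    if kl: "1 \<le> k" "1 \<le> l" for k l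
  proof (cases "root_of q k = root_of q l")
    case False
    then have "(LINT y|?P. X k y * X l y) = 0"
      unfolding X_def using integral_PiM_mult_coordinates[OF root root, of k l] G kl by simp
    then show ?thesis using False by simp
  next
    case True
    let ?i = "root_of q k" and ?j = "exponent_of q k" and ?j' = "exponent_of q l"
    have kl_eq: "k = ?i * q ^ ?j" "l = ?i * q ^ ?j'"
      by (rule root_exponent_decomp[OF q kl(1)], subst True, rule root_exponent_decomp[OF q kl(2)])
    have i: "1 \<le> ?i" "\<not> q dvd ?i" using root[OF kl(1)] by (auto simp: roots_def)
    have "(LINT y|?P. X k y * X l y) = (LINT x|\<mu>. G k x * G l x)"
      unfolding X_def True[symmetric]
      by (rule integral_PiM_coordinate(1)[OF root]) (use kl G in auto)
    also have "\<dots> = cov \<mu> (F k) (F l)" by (simp add: cov_def G_def)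
    also have "\<dots> \<le> C * \<eta> powr (real (?j + ?j') / 2)"
      using assms(10)[OF i, of ?j ?j'] kl_eq by simp
    also have "\<dots> \<le> C * (max \<eta> 2) powr (real (?j + ?j') / 2)"
      using C assms(8) by (intro mult_left_mono powr_mono2) auto
    also have "(max \<eta> 2) powr (real (?j + ?j') / 2) = s ^ (?j + ?j')"
    proof -
      have "s powr real (?j + ?j') = (max \<eta> 2) powr (real (?j + ?j') / 2)"
        unfolding s_def by (subst powr_half_sqrt[symmetric]) (simp_all add: powr_powr)
      then show ?thesis using s by (simp add: powr_realpow del: of_nat_add)
    qed
    finally show ?thesis using True by simp
  qed
  have "(2::real) < real q powr (3 / 2)"
  proof -
    have "(2::real) = 2 powr 1" by simp
    also have "\<dots> < 2 powr (3 / 2)" by (rule powr_less_mono) auto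
    also have "\<dots> \<le> real q powr (3 / 2)" using q by (intro powr_mono2) auto
    finally show ?thesis .
  qed
  then have "s\<^sup>2 < real q powr (3 / 2)" using assms(9) s2 by simp
  moreover have log_iff: "log q (s\<^sup>2) < b \<longleftrightarrow> s\<^sup>2 < real q powr b" for b
    using q s by (intro log_less_iff) auto
  ultimately have "log q (s\<^sup>2) < 3 / 2" by blast
  then have "max 1 (log q (s\<^sup>2)) < 3 / 2" unfolding max_less_iff_conj by simp
  \<comment> \<open>above 1 for the zeta series over the roots, above \<open>log q (s\<^sup>2)\<close> for the geometric series over the powers\<close>
  then obtain \<gamma> where \<gamma>: "max 1 (log q (s\<^sup>2)) < \<gamma>" "\<gamma> < 3 / 2"
    using dense by blast
  then have s\<gamma>: "s\<^sup>2 < real q powr \<gamma>" "1 < \<gamma>"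
    unfolding max_less_iff_conj log_iff by blast+
  obtain K where K: "\<And>n. (LINT y|?P. (\<Sum>k=1..n. X k y)\<^sup>2) \<le> K * real n powr \<gamma>"
    using second_moment_growth[OF q X X2 cross less_imp_le[OF C] s s\<gamma>] by blast
  have "AE y in ?P. (\<lambda>n. (\<Sum>k=1..n. X k y) / real n) \<longlonglongrightarrow> 0"
  proof (rule strong_law_of_second_moments[OF X X2 K \<gamma>(2)])
    show "summable (\<lambda>k. (LINT y|?P. (X k y)\<^sup>2) * real k powr (- 3 / 2))"
    proof (rule summable_comparison_test')
      show "summable (\<lambda>k. C * ((s\<^sup>2) ^ exponent_of q k * real k powr - \<gamma>))"
        using s s\<gamma> by (intro summable_mult summable_exponent_weights q) auto
      fix k :: nat assume k: "1 \<le> k"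
      have "(LINT y|?P. (X k y)\<^sup>2) \<le> C * (s\<^sup>2) ^ exponent_of q k"
        using cross[OF k k] by (simp add: power2_eq_square power_add power_mult_distrib)
      moreover have "real k powr (- 3 / 2) \<le> real k powr - \<gamma>"
        using k \<gamma>(2) by (intro powr_mono) auto
      ultimately have "(LINT y|?P. (X k y)\<^sup>2) * real k powr (- 3 / 2)
          \<le> C * (s\<^sup>2) ^ exponent_of q k * real k powr - \<gamma>"
        using C by (intro mult_mono) auto
      then show "norm ((LINT y|?P. (X k y)\<^sup>2) * real k powr (- 3 / 2))
          \<le> C * ((s\<^sup>2) ^ exponent_of q k * real k powr - \<gamma>)"
        by (simp add: mult.assoc)
    qed
  qed
  then have lim: "AE y in ?P. (\<lambda>n. (1 / real n) *
      (\<Sum>k=1..n. F k (restr q (root_of q k) (assemble q y)) - integral\<^sup>L \<mu> (F k))) \<longlonglongrightarrow> 0"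
    using AE_space
  proof eventually_elim
    case (elim y)
    have "y i \<in> Sigma_space m" if "i \<in> roots q" for i
      using elim(2) that sets_eq_imp_space_eq[OF sets] by (auto simp: space_PiM space_Sigma_borel)
    then have "F k (restr q (root_of q k) (assemble q y)) - integral\<^sup>L \<mu> (F k) = X k y" if "1 \<le> k" for k
      using restr_assemble[where y=y and m=m] q root[OF that] by (simp add: X_def G_def)
    then have "(\<Sum>k=1..n. F k (restr q (root_of q k) (assemble q y)) - integral\<^sup>L \<mu> (F k)) = (\<Sum>k=1..n. X k y)" for n
      by (intro sum.cong) auto
    then show ?case using elim(1) by simp
  qed
  have meas: "(\<lambda>x. F k (restr q (root_of q k) x)) \<in> borel_measurable (Sigma_borel m)" if "1 \<le> k" for k
    by (rule measurable_compose[OF measurable_restr[OF q root[OF that] sets] F[OF that]])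
  have "(\<lambda>x. (1 / real n) * (\<Sum>k=1..n. F k (restr q (root_of q k) x) - integral\<^sup>L \<mu> (F k)))
      \<in> borel_measurable (Sigma_borel m)" for n
    using meas by (intro borel_measurable_times borel_measurable_sum borel_measurable_diff) auto
  then have "Measurable.pred (Sigma_borel m) (\<lambda>x. (\<lambda>n. (1 / real n) *
      (\<Sum>k=1..n. F k (restr q (root_of q k) x) - integral\<^sup>L \<mu> (F k))) \<longlonglongrightarrow> 0)"
    by (rule measurable_limit2) simp
  from AE_distr_iff[OF measurable_assemble[OF q sets] this[unfolded pred_def]] lim
  show ?thesis unfolding telescopic_def by blast
qed

end
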